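(* Let $g\geq2$ be an integer and let $\mathcal{D}=\{d_1,\dots,d_t\}\subseteq\{0,\dots,g-1\}$ be a set of $t\ge2$ distinct digits, where $d_1$ is the smallest digit. Let $a\in\mathbb{N}$ satisfy $\gcd(g,a)=1$ and put $\delta=\gcd(a,d_2-d_1,\dots,d_t-d_1)$. Then: (1) $\mathcal{C}_{g,\mathcal{D}}$ is uniformly distributed mod $a$ if and only if $\delta=1$. (2) If $\delta\neq1$ and $d_1\equiv0\pmod\delta$, then $\mathcal{C}_{g,\mathcal{D}}$ is uniformly distributed in the subgroup $\langle\delta\rangle\subseteq\mathbb{Z}/a\mathbb{Z}$. (3) In any other case, for every $b\in\mathbb{Z}/a\mathbb{Z}$, the limit of $$\frac{|\{n\in\mathcal{C}_{g,\mathcal{D}}: n\equiv b\pmod a\}\cap[0,N)|}{|\mathcal{C}_{g,\mathcal{D}}\cap[0,N)|}$$ as $N\to\infty$ is either zero or does not exist.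
   Context: $\mathbb{N}=\{1,2,\dots\}$ and $\mathbb{N}_0=\mathbb{N}\cup\{0\}$. $\mathcal{C}_{g,\mathcal{D}}=\{\sum_{i=0}^m w_ig^i: m\in\mathbb{N}_0,\ w_i\in\mathcal{D}\}$. A set $A\subseteq\mathbb{N}_0$ is uniformly distributed mod $a$ if $\lim_{N\to\infty}\frac{|\{n\in A: n\equiv b\pmod a\}\cap[0,N)|}{|A\cap[0,N)|}=\frac1a$ for every $b\in\mathbb{Z}/a\mathbb{Z}$. It is uniformly distributed in the subgroup $\langle\delta\rangle$ of $\mathbb{Z}/a\mathbb{Z}$ generated by $\delta$ (where $\delta\mid a$) if this limit equals $\delta/a$ for every $b\in\langle\delta\rangle$ and $\{n\in A: n\equiv b \pmod a\}=\emptyset$ for $b\notin\langle\delta\rangle$. *)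

theory Defs
  imports Complex_Main "HOL-Number_Theory.Cong" "HOL-Algebra.Elementary_Groups"
begin

definition digit_set :: "nat \<Rightarrow> nat set \<Rightarrow> nat set" where
  "digit_set g D = {\<Sum>i\<le>m. w i * g ^ i | m w. \<forall>i\<le>m. w i \<in> D}"

definition residue_ratio :: "nat set \<Rightarrow> nat \<Rightarrow> int \<Rightarrow> nat \<Rightarrow> real" where
  "residue_ratio A a b N =
     real (card ({n \<in> A. [int n = b] (mod int a)} \<inter> {0..<N})) / real (card (A \<inter> {0..<N}))"

text \<open>The group \<open>\<int>/a\<int>\<close> is the library's \<open>integer_mod_group a\<close>, whose carrier is \<open>{0..<int a}\<close>
  for \<open>a > 0\<close>.\<close>

definition unif_distributed_mod :: "nat set \<Rightarrow> nat \<Rightarrow> bool" where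
  "unif_distributed_mod A a \<longleftrightarrow>
     (\<forall>b \<in> carrier (integer_mod_group a). residue_ratio A a b \<longlonglongrightarrow> 1 / real a)"

text \<open>The subgroup of \<open>\<int>/a\<int>\<close> generated by the class of \<open>\<delta>\<close>; the reduction modulo \<open>a\<close> is needed
  because \<open>\<delta> = a\<close> is not itself in the carrier.\<close>

definition residue_subgroup :: "nat \<Rightarrow> nat \<Rightarrow> int set" where
  "residue_subgroup a \<delta> = generate (integer_mod_group a) {int \<delta> mod int a}"

text \<open>Intended for \<open>\<delta> dvd a\<close>, where the subgroup has \<open>a / \<delta>\<close> elements.\<close>

definition unif_distributed_in_subgroup :: "nat set \<Rightarrow> nat \<Rightarrow> nat \<Rightarrow> bool" where
  "unif_distributed_in_subgroup A a \<delta> \<longleftrightarrow>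
     (\<forall>b \<in> residue_subgroup a \<delta>. residue_ratio A a b \<longlonglongrightarrow> real \<delta> / real a) \<and>
     (\<forall>b \<in> carrier (integer_mod_group a) - residue_subgroup a \<delta>.
        {n \<in> A. [int n = b] (mod int a)} = {})"

end

theory Submission
  imports Defs
begin

text \<open>
  Write \<open>e\<close> for the standard additive character modulo \<open>a\<close>, \<open>A\<close> for the set of integers with
  digits in \<open>D\<close>, and \<open>S(h, N)\<close> for the sum of \<open>e(h n)\<close> over \<open>n \<in> A\<close>, \<open>n < N\<close>. Splitting off the
  lowest digit gives \<open>S(h, N) = (\<Sum>d\<in>D. e(h d)) S(g h, N div g) + O(g)\<close>. If \<open>a\<close> does not divide
  \<open>h \<delta>\<close>, the numbers \<open>e(h d)\<close> are not all equal, so the digit sum is at most \<open>r t\<close> in absolute value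
  with a uniform \<open>r < 1\<close>; since \<open>g\<close> is invertible modulo \<open>a\<close>, this iterates along \<open>h, g h, \<dots>\<close> and
  \<open>S(h, N)\<close> is negligible against \<open>|A \<inter> [0, N)|\<close>. If \<open>\<delta>\<close> divides all digits, each of the \<open>\<delta>\<close>
  remaining frequencies contributes fully, which yields the limit \<open>\<delta> / a\<close>. If \<open>\<delta>\<close> does not divide
  \<open>d\<^sub>1\<close>, then 0 is not a digit, the elements of \<open>A\<close> with \<open>L\<close> digits lie in a single residue class
  modulo \<open>\<delta>\<close>, and consecutive \<open>L\<close> give different classes: infinitely often the passage from \<open>g^L\<close>
  to \<open>g^(L+1)\<close> adds nothing to a given class modulo \<open>a\<close> while \<open>|A \<inter> [0, N)|\<close> at least doubles, so
  a limit can only be 0.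
\<close>

section \<open>Additive characters of the integers modulo a\<close>

definition root_char :: "nat \<Rightarrow> int \<Rightarrow> complex" where
  "root_char a x = cis (2 * pi * (of_int x / of_nat a))"

lemma norm_root_char [simp]: "norm (root_char a x) = 1"
  by (simp add: root_char_def)

lemma root_char_add: "root_char a (x + y) = root_char a x * root_char a y"
  by (simp add: root_char_def cis_mult add_divide_distrib distrib_left)

lemma root_char_mult_of_nat: "root_char a (int n * x) = root_char a x ^ n"
  by (simp add: root_char_def Complex.DeMoivre mult_ac)

lemma root_char_eq_1_iff:
  assumes "a > 0"
  shows "root_char a x = 1 \<longleftrightarrow> int a dvd x"
proof
  assume "int a dvd x"
  then obtain k where "x = int a * k" ..
  then show "root_char a x = 1"
    using assms cis_multiple_2pi[of "of_int k"] by (simp add: root_char_def)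
next
  assume "root_char a x = 1"
  then have "cos (2 * pi * (of_int x / of_nat a)) = 1"
    by (metis root_char_def cis.sel(1) one_complex.sel(1))
  then obtain n :: int where "2 * pi * (of_int x / of_nat a) = of_int n * 2 * pi"
    unfolding cos_one_2pi_int by blast
  then have "(of_int x :: real) = of_int (n * int a)"
    using assms by (simp add: field_simps)
  then show "int a dvd x"
    by (metis dvd_triv_right of_int_eq_iff)
qed

lemma root_char_eq_iff:
  assumes "a > 0"
  shows "root_char a x = root_char a y \<longleftrightarrow> int a dvd x - y"
proof -
  have "root_char a x = root_char a (x - y) * root_char a y"
    by (simp flip: root_char_add)
  moreover have "root_char a y \<noteq> 0"
    by (metis norm_root_char norm_zero zero_neq_one)
  ultimately show ?thesis
    using root_char_eq_1_iff[OF assms, of "x - y"] by simp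
qed

text \<open>Orthogonality: this is a geometric sum whose ratio is an \<open>a\<close>-th root of
  unity, so it vanishes unless the ratio is 1.\<close>

lemma sum_root_char:
  assumes "a > 0"
  shows "(\<Sum>h<a. root_char a (int h * x)) = (if int a dvd x then of_nat a else 0)"
proof (cases "int a dvd x")
  case True
  then show ?thesis
    using root_char_eq_1_iff[OF assms, of x] by (simp add: root_char_mult_of_nat)
next
  case False
  then have "root_char a x \<noteq> 1"
    by (simp add: root_char_eq_1_iff assms)
  moreover have "root_char a x ^ a = 1"
    using root_char_eq_1_iff[OF assms, of "int a * x"] by (simp add: root_char_mult_of_nat)
  ultimately show ?thesis
    using False by (simp add: root_char_mult_of_nat geometric_sum)
qed

text \<open>Parallelogram law: a nonzero difference leaves strictly less than 4 for the squared norm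
  of the sum.\<close>

lemma norm_add_unit_less_2:
  fixes z w :: complex
  assumes "norm z = 1" "norm w = 1" "z \<noteq> w"
  shows "norm (z + w) < 2"
proof -
  have "(norm (z + w))\<^sup>2 + (norm (z - w))\<^sup>2 = 2 * (norm z)\<^sup>2 + 2 * (norm w)\<^sup>2"
    by (simp add: cmod_power2) (simp add: power2_eq_square algebra_simps)
  moreover have "(norm (z - w))\<^sup>2 > 0"
    using assms by simp
  moreover have "2 * (norm z)\<^sup>2 + 2 * (norm w)\<^sup>2 = 2\<^sup>2"
    using assms by simp
  ultimately have "(norm (z + w))\<^sup>2 < 2\<^sup>2"
    by linarith
  then show ?thesis
    by (rule power2_less_imp_less) simp
qed

text \<open>One pair of distinct unit vectors already loses something; the triangle inequality
  suffices for all other terms.\<close>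

lemma norm_sum_unit_less_card:
  fixes z :: "'a \<Rightarrow> complex"
  assumes "finite D" "\<And>d. d \<in> D \<Longrightarrow> norm (z d) = 1" "x \<in> D" "y \<in> D" "z x \<noteq> z y"
  shows "norm (sum z D) < card D"
proof -
  have sub: "{x, y} \<subseteq> D" and "x \<noteq> y"
    using assms by auto
  have "norm (sum z (D - {x, y})) \<le> card (D - {x, y})"
    using sum_norm_le[of "D - {x, y}" z "\<lambda>_. 1"] assms(2) by simp
  moreover have "sum z D = sum z (D - {x, y}) + (z x + z y)"
    using sum.subset_diff[OF sub \<open>finite D\<close>, of z] \<open>x \<noteq> y\<close> by simp
  moreover have "card D = card (D - {x, y}) + 2"
    using card_Diff_subset[OF _ sub] card_mono[OF \<open>finite D\<close> sub] \<open>x \<noteq> y\<close> by simp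
  moreover have "norm (z x + z y) < 2"
    using assms by (intro norm_add_unit_less_2) auto
  ultimately show ?thesis
    using norm_triangle_ineq[of "sum z (D - {x, y})" "z x + z y"] by simp
qed

section \<open>Integers with restricted digits\<close>

lemma digit_in_digit_set: "d \<in> D \<Longrightarrow> d \<in> digit_set g D"
  unfolding digit_set_def by (intro CollectI exI[of _ 0] exI[of _ "\<lambda>_. d"]) simp

lemma digit_set_append:
  assumes "n \<in> digit_set g D" "d \<in> D"
  shows "g * n + d \<in> digit_set g D"
proof -
  obtain m w where w: "n = (\<Sum>i\<le>m. w i * g ^ i)" "\<forall>i\<le>m. w i \<in> D"
    using assms(1) unfolding digit_set_def by blast
  \<comment> \<open>\<open>case_nat d w\<close> shifts the digits up by one place and puts
    \<open>d\<close> in the lowest place.\<close>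
  have "g * n + d = (\<Sum>i\<le>Suc m. case_nat d w i * g ^ i)"
    by (simp add: w(1) sum.atMost_Suc_shift sum_distrib_left mult_ac del: sum.atMost_Suc)
  moreover have "\<forall>i\<le>Suc m. case_nat d w i \<in> D"
    using w(2) assms(2) by (auto split: nat.split)
  ultimately show ?thesis
    unfolding digit_set_def by blast
qed

text \<open>Single digits need a case of their own: if 0 is not in \<open>D\<close>, the empty
  leading part 0 is not in the digit set. If 0 is in \<open>D\<close>, the cases overlap.\<close>

lemma digit_set_cases:
  assumes "n \<in> digit_set g D"
  obtains "n \<in> D" | n' d where "n' \<in> digit_set g D" "d \<in> D" "n = g * n' + d"
proof -
  obtain m w where w: "n = (\<Sum>i\<le>m. w i * g ^ i)" "\<forall>i\<le>m. w i \<in> D"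
    using assms unfolding digit_set_def by blast
  show ?thesis
  proof (cases m)
    case 0
    then show ?thesis using w that(1) by simp
  next
    case (Suc k)
    have "n = g * (\<Sum>i\<le>k. w (Suc i) * g ^ i) + w 0"
      by (simp add: w(1) Suc sum.atMost_Suc_shift sum_distrib_left mult_ac del: sum.atMost_Suc)
    moreover have "(\<Sum>i\<le>k. w (Suc i) * g ^ i) \<in> digit_set g D"
      unfolding digit_set_def using w(2) Suc
      by (intro CollectI exI[of _ k] exI[of _ "\<lambda>i. w (Suc i)"]) auto
    ultimately show ?thesis
      using that(2) w(2) by blast
  qed
qed

lemma digit_set_dvd:
  assumes "\<And>d. d \<in> D \<Longrightarrow> m dvd d" "n \<in> digit_set g D"
  shows "m dvd n"
  using assms unfolding digit_set_def by (auto intro!: dvd_sum dvd_mult2)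

locale restricted_digits =
  fixes g :: nat and D :: "nat set"
  assumes base: "2 \<le> g" and digits_less: "D \<subseteq> {..<g}" and card_digits: "2 \<le> card D"
begin

definition below :: "nat \<Rightarrow> nat set" where
  "below N = digit_set g D \<inter> {0..<N}"

lemma finite_digits [simp]: "finite D"
  using digits_less finite_subset by blast

lemma finite_below [simp]: "finite (below N)"
  by (simp add: below_def)

lemma inj_on_append: "inj_on (\<lambda>(n, d). g * n + d) (X \<times> D)"
proof (rule inj_onI, clarify)
  fix n d n' d'
  assume *: "d \<in> D" "d' \<in> D" "g * n + d = g * n' + d'"
  then have "d < g" "d' < g" using digits_less by auto
  then have "(g * n + d) div g = n" "(g * n + d) mod g = d"
       "(g * n' + d') div g = n'" "(g * n' + d') mod g = d'" by auto
  then show "n = n' \<and> d = d'" using *(3) by simp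
qed

lemma append_below:
  "(\<lambda>(n, d). g * n + d) ` (below (N div g) \<times> D) \<subseteq> below N"
proof clarify
  fix n d assume *: "n \<in> below (N div g)" "d \<in> D"
  then have "d < g" using digits_less by auto
  moreover have "g * Suc n \<le> g * (N div g)"
    using * by (intro mult_le_mono2) (simp add: below_def)
  moreover have "g * (N div g) \<le> N" by simp
  ultimately have "g * n + d < N" by (subst (asm) mult_Suc_right) linarith
  then show "g * n + d \<in> below N"
    using * digit_set_append by (simp add: below_def)
qed

text \<open>Two blocks of length \<open>g\<close> can be missed: the single digits, and the top
  block, where the leading part is at least \<open>N div g\<close>.\<close>

lemma below_remainder:
  "card (below N - (\<lambda>(n, d). g * n + d) ` (below (N div g) \<times> D)) \<le> 2 * g"
proof -
  have "below N - (\<lambda>(n, d). g * n + d) ` (below (N div g) \<times> D)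
        \<subseteq> {0..<g} \<union> {g * (N div g)..<g * (N div g) + g}" (is "?L \<subseteq> ?R")
  proof
    fix n assume n: "n \<in> ?L"
    then have "n \<in> digit_set g D" "n < N" by (auto simp: below_def)
    then show "n \<in> ?R"
    proof (cases rule: digit_set_cases)
      case 1
      then show ?thesis using digits_less by auto
    next
      case (2 n' d)
      then have "\<not> n' < N div g"
        using n by (force simp: below_def)
      then have "g * (N div g) \<le> g * n'" by (intro mult_le_mono2) simp
      moreover have "N < g * (N div g) + g"
        using base by (metis dividend_less_times_div add.commute less_le_trans zero_less_numeral)
      ultimately have "n \<in> {g * (N div g)..<g * (N div g) + g}"
        unfolding atLeastLessThan_iff using 2 \<open>n < N\<close> by linarith
      then show ?thesis ..
    qed
  qed
  then have "card ?L \<le> card ?R" by (intro card_mono) auto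
  also have "\<dots> \<le> 2 * g" by (rule card_Un_le[THEN order_trans]) simp
  finally show ?thesis .
qed

text \<open>Lets the factor \<open>card D\<close> from each digit sum be absorbed into the count,
  and later shows that the count at least doubles from one power of \<open>g\<close> to the
  next.\<close>

lemma card_below_mult: "card D * card (below (N div g)) \<le> card (below N)"
proof -
  have "card D * card (below (N div g))
      = card ((\<lambda>(n, d). g * n + d) ` (below (N div g) \<times> D))"
    by (simp add: card_image inj_on_append card_cartesian_product)
  also have "\<dots> \<le> card (below N)"
    by (intro card_mono append_below finite_below)
  finally show ?thesis .
qed

text \<open>Appending a nonzero digit, which exists since \<open>D\<close> has two elements, would
  exceed the maximum of a finite set.\<close>

lemma infinite_digit_set: "infinite (digit_set g D)"
proof
  assume fin: "finite (digit_set g D)"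
  have "\<not> D \<subseteq> {0}"
    using card_digits card_mono[of "{0}" D] by auto
  then obtain d where d: "d \<in> D" "d > 0" by auto
  let ?M = "Max (digit_set g D)"
  have "?M \<in> digit_set g D"
    using fin d digit_in_digit_set by (metis Max_in empty_iff)
  then have "g * ?M + d \<le> ?M"
    using fin d digit_set_append by (simp add: Max_ge)
  moreover have "1 * ?M \<le> g * ?M" using base by (intro mult_le_mono1) simp
  ultimately show False using d by simp
qed

lemma card_below_at_top: "filterlim (\<lambda>N. real (card (below N))) at_top sequentially"
proof (rule filterlim_compose[OF filterlim_real_sequentially], unfold filterlim_at_top, intro allI)
  fix Z
  obtain B where B: "finite B" "card B = Z" "B \<subseteq> digit_set g D"
    using infinite_arbitrarily_large[OF infinite_digit_set] by blast
  then obtain M where M: "\<forall>n\<in>B. n < M"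
    using finite_nat_set_iff_bounded by blast
  have "Z \<le> card (below N)" if "N \<ge> M" for N
  proof -
    have "B \<subseteq> below N" using B M that by (force simp: below_def)
    then show ?thesis using B(2) card_mono finite_below by blast
  qed
  then show "\<forall>\<^sub>F N in sequentially. Z \<le> card (below N)"
    using eventually_sequentially by blast
qed

section \<open>Exponential sums and their recursion\<close>

definition digit_char_sum :: "nat \<Rightarrow> nat \<Rightarrow> complex" where
  "digit_char_sum a h = (\<Sum>d\<in>D. root_char a (int h * int d))"

definition char_sum :: "nat \<Rightarrow> nat \<Rightarrow> nat \<Rightarrow> complex" where
  "char_sum a h N = (\<Sum>n\<in>below N. root_char a (int h * int n))"

text \<open>Splitting off the lowest digit factors the exponential sum, up to at most \<open>2 * g\<close>
  elements at the two ends of the interval.\<close>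

lemma char_sum_step:
  "norm (char_sum a h N)
     \<le> norm (digit_char_sum a h) * norm (char_sum a (g * h) (N div g)) + 2 * g"
proof -
  define T where "T = (\<lambda>(n, d). g * n + d) ` (below (N div g) \<times> D)"
  let ?f = "\<lambda>n. root_char a (int h * int n)"
  have "sum ?f T = (\<Sum>(n, d)\<in>below (N div g) \<times> D. ?f (g * n + d))"
    unfolding T_def by (subst sum.reindex[OF inj_on_append]) (simp add: case_prod_unfold)
  also have "\<dots> = (\<Sum>n\<in>below (N div g). \<Sum>d\<in>D. root_char a (int (g * h) * int n) * ?f d)"
    unfolding sum.cartesian_product[symmetric]
    by (intro sum.cong refl) (simp add: algebra_simps flip: root_char_add)
  also have "\<dots> = char_sum a (g * h) (N div g) * digit_char_sum a h"
    by (simp add: char_sum_def digit_char_sum_def sum_product)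
  finally have T: "sum ?f T = char_sum a (g * h) (N div g) * digit_char_sum a h" .
  have "char_sum a h N = sum ?f (below N - T) + sum ?f T"
    unfolding char_sum_def using append_below by (intro sum.subset_diff) (auto simp: T_def)
  moreover have "norm (sum ?f (below N - T)) \<le> card (below N - T)"
    using sum_norm_le[of "below N - T" ?f "\<lambda>_. 1"] by simp
  moreover have "card (below N - T) \<le> 2 * g"
    unfolding T_def by (rule below_remainder)
  ultimately show ?thesis
    using norm_triangle_ineq[of "sum ?f (below N - T)" "sum ?f T"]
    unfolding T norm_mult by (simp add: mult.commute[of "norm (digit_char_sum a h)"])
qed

lemma norm_char_sum_le: "norm (char_sum a h N) \<le> card (below N)"
  unfolding char_sum_def using sum_norm_le[of "below N" "\<lambda>n. root_char a (int h * int n)" "\<lambda>_. 1"]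
  by simp

end

section \<open>Cancellation in the exponential sums\<close>

locale restricted_digits_mod = restricted_digits +
  fixes a \<delta> d\<^sub>1 :: nat
  assumes modulus: "a > 0" and coprime_base: "coprime g a"
    and first_digit: "d\<^sub>1 \<in> D" "\<And>d. d \<in> D \<Longrightarrow> d\<^sub>1 \<le> d"
    and delta: "\<delta> = Gcd (insert a ((\<lambda>d. d - d\<^sub>1) ` D))"
begin

lemma delta_dvd: "\<delta> dvd a"
  by (simp add: delta)

lemma delta_pos: "\<delta> > 0"
  using delta_dvd modulus by (auto intro: Nat.gr0I)

lemma digit_cong_delta:
  assumes "d \<in> D"
  shows "[d = d\<^sub>1] (mod \<delta>)"
proof -
  have "\<delta> dvd d - d\<^sub>1"
    unfolding delta using assms by (intro Gcd_dvd) auto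
  then show ?thesis
    using first_digit(2)[OF assms] by (simp add: cong_altdef_nat)
qed

lemma delta_dvd_digit_set:
  assumes "\<delta> dvd d\<^sub>1" "n \<in> digit_set g D"
  shows "\<delta> dvd n"
proof (rule digit_set_dvd[OF _ assms(2)])
  fix d assume "d \<in> D"
  then show "\<delta> dvd d"
    using digit_cong_delta cong_dvd_iff cong_sym assms(1) by blast
qed

text \<open>Multiplication by \<open>h\<close> commutes with \<open>Gcd\<close>, and the entry
  \<open>h * a\<close> imposes no condition. So \<open>a dvd h * \<delta>\<close> says exactly that
  all phases of the digit sum coincide.\<close>

lemma dvd_mult_delta_iff: "a dvd h * \<delta> \<longleftrightarrow> (\<forall>d\<in>D. a dvd h * (d - d\<^sub>1))"
proof -
  have "h * \<delta> = Gcd ((*) h ` insert a ((\<lambda>d. d - d\<^sub>1) ` D))"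
    by (simp add: Gcd_mult delta del: Gcd_insert image_insert)
  then show ?thesis
    by (simp add: dvd_Gcd_iff del: Gcd_insert)
qed

lemma norm_digit_char_sum_less:
  assumes "\<not> a dvd h * \<delta>"
  shows "norm (digit_char_sum a h) < card D"
proof -
  obtain d where d: "d \<in> D" "\<not> a dvd h * (d - d\<^sub>1)"
    using assms dvd_mult_delta_iff by blast
  have "int h * int d - int h * int d\<^sub>1 = int (h * (d - d\<^sub>1))"
    using first_digit(2)[OF d(1)] by (simp add: of_nat_diff right_diff_distrib)
  then have "root_char a (int h * int d) \<noteq> root_char a (int h * int d\<^sub>1)"
    using d(2) root_char_eq_iff[OF modulus] by (metis int_dvd_int_iff)
  then show ?thesis
    unfolding digit_char_sum_def using d(1) first_digit(1) by (intro norm_sum_unit_less_card) auto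
qed

lemma digit_char_sum_mod: "digit_char_sum a (h mod a) = digit_char_sum a h"
  unfolding digit_char_sum_def
proof (intro sum.cong refl)
  fix d
  have "int a dvd int (h mod a) - int h"
    by (metis mod_eq_dvd_iff mod_mod_trivial zmod_int)
  then have "int a dvd int (h mod a) * int d - int h * int d"
    by (simp add: dvd_mult2 flip: left_diff_distrib)
  then show "root_char a (int (h mod a) * int d) = root_char a (int h * int d)"
    using root_char_eq_iff[OF modulus] by simp
qed

lemma digit_char_sum_contraction:
  "\<exists>r::real. 0 \<le> r \<and> r < 1 \<and>
     (\<forall>h. \<not> a dvd h * \<delta> \<longrightarrow> norm (digit_char_sum a h) \<le> r * card D)"
proof -
  \<comment> \<open>Only the frequencies below \<open>a\<close> matter, so a maximum exists. The
    extra 0 keeps \<open>R\<close> nonempty when \<open>\<delta> = a\<close> and makes the maximum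
    nonnegative.\<close>
  define R where "R = insert 0 ((\<lambda>h. norm (digit_char_sum a h) / card D) ` {h. h < a \<and> \<not> a dvd h * \<delta>})"
  have "finite R" "R \<noteq> {}" by (auto simp: R_def)
  moreover have "\<forall>x\<in>R. x < 1"
    using norm_digit_char_sum_less card_digits by (auto simp: R_def divide_less_eq)
  ultimately have "Max R < 1" by simp
  moreover have "0 \<le> Max R" using \<open>finite R\<close> by (simp add: R_def)
  moreover have "norm (digit_char_sum a h) \<le> Max R * card D" if "\<not> a dvd h * \<delta>" for h
  proof -
    have "\<not> a dvd (h mod a) * \<delta>"
      using that by (metis dvd_imp_mod_0 mod_0_imp_dvd mod_mult_left_eq)
    then have "norm (digit_char_sum a (h mod a)) / card D \<in> R"
      using modulus by (auto simp: R_def)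
    then have "norm (digit_char_sum a h) / card D \<le> Max R"
      using \<open>finite R\<close> by (simp add: digit_char_sum_mod)
    then show ?thesis using card_digits by (simp add: divide_le_eq)
  qed
  ultimately show ?thesis by blast
qed

text \<open>The constant may depend on \<open>k\<close> but must be uniform in \<open>h\<close> and
  \<open>N\<close>, because the induction step passes to \<open>g * h\<close> and
  \<open>N div g\<close>.\<close>

lemma char_sum_bound:
  fixes r :: real
  assumes r: "0 \<le> r" "\<And>h. \<not> a dvd h * \<delta> \<Longrightarrow> norm (digit_char_sum a h) \<le> r * card D"
  shows "\<exists>c. \<forall>h N. \<not> a dvd h * \<delta> \<longrightarrow> norm (char_sum a h N) \<le> r ^ k * card (below N) + c"
proof (induction k)
  case 0
  show ?case using norm_char_sum_le by (intro exI[of _ 0]) simp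
next
  case (Suc k)
  then obtain c where c: "\<And>h N. \<not> a dvd h * \<delta> \<Longrightarrow> norm (char_sum a h N) \<le> r ^ k * card (below N) + c"
    by blast
  have "norm (char_sum a h N) \<le> r ^ Suc k * card (below N) + (r * card D * c + 2 * g)"
    if h: "\<not> a dvd h * \<delta>" for h N
  proof -
    \<comment> \<open>The new frequency stays admissible because \<open>g\<close> is invertible
      modulo \<open>a\<close>.\<close>
    have gh: "\<not> a dvd g * h * \<delta>"
      using h coprime_base by (simp add: coprime_commute coprime_dvd_mult_right_iff mult.assoc)
    have "norm (char_sum a h N)
        \<le> norm (digit_char_sum a h) * norm (char_sum a (g * h) (N div g)) + 2 * g"
      by (rule char_sum_step)
    also have "\<dots> \<le> (r * card D) * (r ^ k * card (below (N div g)) + c) + 2 * g"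
      using r(2)[OF h] c[OF gh] r(1) by (intro add_right_mono mult_mono) auto
    also have "\<dots> = r ^ Suc k * real (card D * card (below (N div g))) + (r * card D * c + 2 * g)"
      by (simp add: algebra_simps)
    also have "\<dots> \<le> r ^ Suc k * card (below N) + (r * card D * c + 2 * g)"
      using r(1) card_below_mult[of N] by (intro add_right_mono mult_left_mono) (auto simp del: of_nat_mult)
    finally show ?thesis .
  qed
  then show ?case by blast
qed

lemma char_sum_tendsto_0:
  assumes h: "\<not> a dvd h * \<delta>"
  shows "(\<lambda>N. char_sum a h N / card (below N)) \<longlonglongrightarrow> 0"
proof (rule LIMSEQ_I)
  fix e :: real assume "e > 0"
  obtain r :: real where r: "0 \<le> r" "r < 1"
    "\<And>h. \<not> a dvd h * \<delta> \<Longrightarrow> norm (digit_char_sum a h) \<le> r * card D"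
    using digit_char_sum_contraction by metis
  obtain k where k: "r ^ k < e / 2"
    using real_arch_pow_inv[of "e / 2" r] \<open>e > 0\<close> r by auto
  obtain c where c: "\<And>N. norm (char_sum a h N) \<le> r ^ k * card (below N) + c"
    using char_sum_bound[OF r(1,3), of k] h by blast
  \<comment> \<open>With \<open>k\<close> and hence \<open>c\<close> fixed, the bound
    \<open>2 * c / e\<close> pushes \<open>c\<close> below half of the allowed error; the 0 keeps
    the denominator positive.\<close>
  have "\<forall>\<^sub>F N in sequentially. card (below N) > max 0 (2 * c / e)"
    using card_below_at_top unfolding filterlim_at_top_dense by blast
  then obtain N0 where N0: "\<And>N. N \<ge> N0 \<Longrightarrow> card (below N) > max 0 (2 * c / e)"
    unfolding eventually_sequentially by blast
  have "norm (char_sum a h N / card (below N) - 0) < e" if "N \<ge> N0" for N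
  proof -
    have pos: "real (card (below N)) > 0" and "c < e / 2 * card (below N)"
      using N0[OF that] \<open>e > 0\<close> by (auto simp: field_simps)
    moreover have "r ^ k * card (below N) < e / 2 * card (below N)"
      using k pos by (intro mult_strict_right_mono)
    ultimately have "norm (char_sum a h N) < e * card (below N)"
      using c[of N] by linarith
    then show ?thesis using pos by (simp add: norm_divide divide_less_eq)
  qed
  then show "\<exists>N0. \<forall>N\<ge>N0. norm (char_sum a h N / card (below N) - 0) < e"
    by blast
qed

section \<open>Limits of the ratios when \<open>\<delta>\<close> divides the smallest digit\<close>

lemma card_frequencies: "card {h. h < a \<and> a dvd h * \<delta>} = \<delta>"
proof -
  obtain q where q: "a = q * \<delta>" using delta_dvd by (metis dvd_def mult.commute)
  then have "q > 0" using modulus by (auto intro: Nat.gr0I)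
  \<comment> \<open>With \<open>a = q * \<delta>\<close>, the condition on \<open>h\<close> is
    divisibility by \<open>q\<close>.\<close>
  have "{h. h < a \<and> a dvd h * \<delta>} = (*) q ` {..<\<delta>}"
    using q \<open>q > 0\<close> delta_pos by (auto simp: image_iff elim!: dvdE)
  then show ?thesis
    using \<open>q > 0\<close> by (simp add: card_image inj_on_def)
qed

lemma residue_ratio_tendsto:
  assumes d1: "\<delta> dvd d\<^sub>1" and b: "int \<delta> dvd b"
  shows "residue_ratio (digit_set g D) a b \<longlonglongrightarrow> \<delta> / a"
proof -
  let ?F = "\<lambda>N h. root_char a (- (int h * b)) * (char_sum a h N / card (below N))"
  \<comment> \<open>Orthogonality over all frequencies detects the class of \<open>b\<close>. If
    \<open>below N\<close> is empty, both sides are 0 since division by 0 gives 0.\<close>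
  have ratio: "complex_of_real (residue_ratio (digit_set g D) a b N) = (\<Sum>h<a. ?F N h) / a" for N
  proof -
    have "(\<Sum>h<a. ?F N h) = (\<Sum>h<a. \<Sum>n\<in>below N. root_char a (int h * (int n - b))) / card (below N)"
      unfolding char_sum_def sum_divide_distrib sum_distrib_left
      by (intro sum.cong refl) (simp add: algebra_simps flip: root_char_add)
    also have "\<dots> = (\<Sum>n\<in>below N. \<Sum>h<a. root_char a (int h * (int n - b))) / card (below N)"
      by (subst sum.swap) (rule refl)
    also have "\<dots> = (\<Sum>n\<in>below N. if [int n = b] (mod int a) then (of_nat :: nat \<Rightarrow> complex) a else 0) / card (below N)"
      by (simp add: sum_root_char modulus cong_iff_dvd_diff)
    also have "\<dots> = of_nat (card (below N \<inter> {n. [int n = b] (mod int a)})) * of_nat a / card (below N)"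
      by (simp add: sum.If_cases)
    also have "below N \<inter> {n. [int n = b] (mod int a)}
        = {n \<in> digit_set g D. [int n = b] (mod int a)} \<inter> {0..<N}"
      by (auto simp: below_def)
    finally show ?thesis
      using modulus by (simp add: residue_ratio_def below_def)
  qed
  have lim: "(\<lambda>N. ?F N h) \<longlonglongrightarrow> (if a dvd h * \<delta> then 1 else 0)" for h
  proof (cases "a dvd h * \<delta>")
    case False
    then show ?thesis
      using tendsto_mult[OF tendsto_const char_sum_tendsto_0] by auto
  next
    case True
    then have h: "int a dvd int h * int \<delta>" by (metis int_dvd_int_iff of_nat_mult)
    have trivial: "root_char a (int h * x) = 1" if "int \<delta> dvd x" for x
      unfolding root_char_eq_1_iff[OF modulus] using h that by (meson dvd_refl dvd_trans mult_dvd_mono)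
    have "char_sum a h N = card (below N)" for N
      unfolding char_sum_def using delta_dvd_digit_set[OF d1] by (simp add: trivial below_def)
    moreover have "root_char a (- (int h * b)) = 1"
      using trivial[of "- b"] b by simp
    \<comment> \<open>Needed because the quotient is 0 instead of 1 while \<open>below N\<close> is
      empty.\<close>
    moreover have "\<forall>\<^sub>F N in sequentially. card (below N) > (0 :: real)"
      using card_below_at_top unfolding filterlim_at_top_dense by blast
    ultimately have "\<forall>\<^sub>F N in sequentially. ?F N h = 1"
      by (auto elim!: eventually_mono)
    then show ?thesis
      using True by (simp only: tendsto_eventually if_True)
  qed
  have "(\<lambda>N. (\<Sum>h<a. ?F N h) / of_nat a) \<longlonglongrightarrow> (\<Sum>h<a. if a dvd h * \<delta> then 1 else 0) / of_nat a"
    by (intro tendsto_intros lim) (use modulus in simp)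
  also have "(\<Sum>h<a. if a dvd h * \<delta> then 1 else 0 :: complex) = of_nat \<delta>"
    using card_frequencies by (simp add: sum.If_cases Int_def lessThan_def)
  finally have "(\<lambda>N. complex_of_real (residue_ratio (digit_set g D) a b N)) \<longlonglongrightarrow> complex_of_real (\<delta> / a)"
    by (simp add: ratio)
  then show ?thesis
    by (simp only: tendsto_of_real_iff)
qed

section \<open>Exclusion of nonzero limits\<close>

lemma residue_ratio_limit_0:
  assumes d1: "\<not> \<delta> dvd d\<^sub>1" and lim: "residue_ratio (digit_set g D) a b \<longlonglongrightarrow> x"
  shows "x = 0"
proof -
  let ?r = "residue_ratio (digit_set g D) a b"
  \<comment> \<open>\<open>c L\<close> has \<open>L + 1\<close> digits, all equal to
    \<open>d\<^sub>1\<close>; it represents the class modulo \<open>\<delta>\<close> of all elements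
    with \<open>L + 1\<close> digits.\<close>
  define c where "c = rec_nat d\<^sub>1 (\<lambda>_ m. g * m + d\<^sub>1)"
  have c0: "c 0 = d\<^sub>1" and cSuc: "c (Suc L) = g * c L + d\<^sub>1" for L
    by (simp_all add: c_def)
  have coprime: "coprime g \<delta>"
    using coprime_base delta_dvd coprime_divisors dvd_refl by blast
  \<comment> \<open>The first difference is \<open>g * d\<^sub>1\<close> and each further one is
    \<open>g\<close> times its predecessor, with \<open>g\<close> invertible modulo
    \<open>\<delta>\<close>.\<close>
  have distinct: "\<not> [c (Suc L) = c L] (mod \<delta>)" for L
  proof (induction L)
    case 0
    have "\<not> \<delta> dvd g * d\<^sub>1"
      using d1 coprime by (simp add: coprime_commute coprime_dvd_mult_right_iff)
    then show ?case
      by (simp add: c0 cSuc cong_iff_dvd_diff flip: cong_int_iff int_dvd_int_iff)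
  next
    case (Suc L)
    then show ?case
      using coprime by (simp add: cSuc[of "Suc L"] cSuc[of L] cong_add_rcancel_nat cong_mult_lcancel_nat)
  qed
  text \<open>Since 0 is not a digit, the size of an element determines its number of digits, and all
    elements with the same number of digits agree modulo \<open>\<delta>\<close>.\<close>
  have digits_pos: "d > 0" if "d \<in> D" for d
    using that d1 first_digit(2)[OF that] by (auto intro: Nat.gr0I)
  have elem_pos: "n > 0" if "n \<in> digit_set g D" for n
    using that digits_pos by (cases rule: digit_set_cases) auto
  have size_class: "[n = c L] (mod \<delta>)" if "n \<in> digit_set g D" "g ^ L \<le> n" "n < g ^ Suc L" for n L
    using that
  proof (induction L arbitrary: n)
    case 0
    from 0(1) have "n \<in> D"
    proof (cases rule: digit_set_cases)
      case (2 n' d)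
      have "g * 1 \<le> g * n'" using elem_pos[OF 2(1)] by (intro mult_le_mono2) simp
      then have "g \<le> n" unfolding 2(3) by (metis mult.right_neutral trans_le_add1)
      then have False using 0(3) by simp
      then show ?thesis ..
    qed
    then show ?case using digit_cong_delta by (simp add: c0)
  next
    case (Suc L)
    from Suc(2) show ?case
    proof (cases rule: digit_set_cases)
      case 1
      then have "n < g" using digits_less by auto
      also have "g \<le> g ^ Suc L" using base power_increasing[of 1 "Suc L" g] by simp
      finally show ?thesis using Suc.prems(2) by simp
    next
      case (2 n' d)
      have "d < g" using 2 digits_less by auto
      then have "n div g = n'" using 2 by simp
      moreover have "g ^ L \<le> n div g"
        using Suc base by (simp add: less_eq_div_iff_mult_less_eq mult.commute)
      moreover have "n div g < g ^ Suc L"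
        using Suc base by (simp add: div_less_iff_less_mult mult.commute)
      ultimately have "[n' = c L] (mod \<delta>)" using Suc.IH 2 by blast
      then show ?thesis
        unfolding 2(3) cSuc using digit_cong_delta[OF 2(2)] by (intro cong_add cong_scalar_left)
    qed
  qed
  have halving: "2 * ?r (g ^ Suc L) \<le> ?r (g ^ L)" if L: "\<not> [int (c L) = b] (mod int \<delta>)" for L
  proof -
    let ?B = "\<lambda>N. {n \<in> digit_set g D. [int n = b] (mod int a)} \<inter> {0..<N}"
    have mono: "g ^ L \<le> g ^ Suc L" using base by simp
    have "n < g ^ L" if n: "n \<in> ?B (g ^ Suc L)" for n
    proof (rule ccontr)
      assume "\<not> n < g ^ L"
      then have "[int n = int (c L)] (mod int \<delta>)"
        using size_class[of n L] n by (simp add: cong_int_iff)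
      moreover have "[int n = b] (mod int \<delta>)"
        by (rule cong_dvd_modulus[of _ _ "int a"]) (use n delta_dvd in auto)
      ultimately show False using L cong_sym cong_trans by blast
    qed
    then have same: "?B (g ^ Suc L) = ?B (g ^ L)"
      using less_le_trans[OF _ mono] by (auto simp del: power_Suc)
    have double: "2 * card (below (g ^ L)) \<le> card (below (g ^ Suc L))"
      using card_below_mult[of "g ^ Suc L"] base
      by (intro order_trans[OF mult_le_mono1[OF card_digits]]) simp
    show ?thesis
    proof (cases "card (below (g ^ L)) = 0")
      case True
      moreover have "?B (g ^ L) \<subseteq> below (g ^ L)" by (auto simp: below_def)
      ultimately have "?B (g ^ L) = {}" by simp
      then show ?thesis unfolding residue_ratio_def same by simp
    next
      case False
      then have "card (?B (g ^ L)) / real (card (below (g ^ Suc L)))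
          \<le> card (?B (g ^ L)) / real (2 * card (below (g ^ L)))"
        by (intro frac_le of_nat_0_le_iff order_refl of_nat_mono double) linarith
      then show ?thesis
        unfolding residue_ratio_def below_def[symmetric] same by simp
    qed
  qed
  have limL: "(\<lambda>L. ?r (g ^ L)) \<longlonglongrightarrow> x"
    using base by (intro filterlim_compose[OF lim] filterlim_subseq strict_monoI power_strict_increasing) auto
  have lim_diff: "(\<lambda>L. 2 * ?r (g ^ Suc L) - ?r (g ^ L)) \<longlonglongrightarrow> 2 * x - x"
    by (rule tendsto_diff[OF tendsto_mult[OF tendsto_const LIMSEQ_Suc[OF limL]] limL])
  \<comment> \<open>Of two consecutive \<open>L\<close>, at most one has \<open>c L\<close>
    congruent to \<open>b\<close>, so \<open>halving\<close> applies infinitely often. A positive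
    limit \<open>2 * x - x\<close> would make the difference eventually positive.\<close>
  have "\<exists>\<^sub>F L in sequentially. \<not> 0 < 2 * ?r (g ^ Suc L) - ?r (g ^ L)"
    unfolding frequently_sequentially
  proof
    fix M
    have "\<not> [int (c M) = b] (mod int \<delta>) \<or> \<not> [int (c (Suc M)) = b] (mod int \<delta>)"
      using distinct[of M] by (metis cong_int_iff cong_sym cong_trans)
    then have "2 * ?r (g ^ Suc M) - ?r (g ^ M) \<le> 0 \<or> 2 * ?r (g ^ Suc (Suc M)) - ?r (g ^ Suc M) \<le> 0"
      using halving by (simp only: le_diff_eq diff_le_eq add_0) blast
    then show "\<exists>L\<ge>M. \<not> 0 < 2 * ?r (g ^ Suc L) - ?r (g ^ L)"
      by (meson le_SucI not_le order_refl)
  qed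
  then have "\<not> 0 < 2 * x - x"
    unfolding frequently_def not_not by (rule contrapos_nn) (rule order_tendstoD(1)[OF lim_diff])
  moreover have "0 \<le> x"
    by (rule LIMSEQ_le_const[OF lim]) (simp add: residue_ratio_def)
  ultimately show ?thesis by simp
qed

end

section \<open>Uniform distribution in a subgroup\<close>

text \<open>Reduction modulo \<open>a\<close> preserves divisibility by \<open>\<delta>\<close>
  because \<open>\<delta>\<close> divides \<open>a\<close>; conversely, a reduced multiple of
  \<open>\<delta>\<close> is its own residue.\<close>

lemma residue_subgroup_eq:
  assumes "a > 0" "\<delta> dvd a"
  shows "residue_subgroup a \<delta> = {b \<in> carrier (integer_mod_group a). int \<delta> dvd b}"
proof -
  have "int \<delta> mod int a \<in> carrier (integer_mod_group a)"
    using assms by (simp add: carrier_integer_mod_group)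
  then have "residue_subgroup a \<delta> = {k * int \<delta> mod int a | k. True}"
    unfolding residue_subgroup_def
    by (simp add: group.generate_pow int_pow_integer_mod_group mod_mult_right_eq)
  also have "\<dots> = {b \<in> carrier (integer_mod_group a). int \<delta> dvd b}"
  proof (intro subset_antisym subsetI)
    fix b assume "b \<in> {b \<in> carrier (integer_mod_group a). int \<delta> dvd b}"
    then have "b mod int a = b" "int \<delta> dvd b"
      using assms by (auto simp: carrier_integer_mod_group)
    then show "b \<in> {k * int \<delta> mod int a | k. True}"
      by (metis (mono_tags, lifting) dvd_div_mult_self mem_Collect_eq)
  qed (use assms in \<open>auto simp: carrier_integer_mod_group dvd_mod\<close>)
  finally show ?thesis .
qed

context restricted_digits_mod
begin

lemma unif_distributed_in_subgroup_delta:
  assumes d1: "\<delta> dvd d\<^sub>1"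
  shows "unif_distributed_in_subgroup (digit_set g D) a \<delta>"
proof -
  have "int \<delta> dvd b" if "n \<in> digit_set g D" "[int n = b] (mod int a)" for n b
  proof -
    have "\<delta> dvd n"
      using delta_dvd_digit_set[OF d1] that by blast
    then have "int \<delta> dvd int n" by simp
    moreover have "[int n = b] (mod int \<delta>)"
      using that(2) by (rule cong_dvd_modulus) (simp add: delta_dvd)
    ultimately show ?thesis using cong_dvd_iff by blast
  qed
  then show ?thesis
    unfolding unif_distributed_in_subgroup_def residue_subgroup_eq[OF modulus delta_dvd]
    using residue_ratio_tendsto[OF d1] by (intro conjI ballI) blast+
qed

lemma unif_distributed_mod_iff: "unif_distributed_mod (digit_set g D) a \<longleftrightarrow> \<delta> = 1"
proof
  assume "\<delta> = 1"
  then show "unif_distributed_mod (digit_set g D) a"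
    unfolding unif_distributed_mod_def using residue_ratio_tendsto by auto
next
  assume unif: "unif_distributed_mod (digit_set g D) a"
  show "\<delta> = 1"
  proof (rule ccontr)
    assume "\<delta> \<noteq> 1"
    then have "a \<noteq> 1" using delta_dvd by auto
    then have one: "1 \<in> carrier (integer_mod_group a)" by simp
    then have lim: "residue_ratio (digit_set g D) a 1 \<longlonglongrightarrow> 1 / a"
      using unif unfolding unif_distributed_mod_def by blast
    \<comment> \<open>The class of 1 refutes uniformity: either no element lies in it, or any limit
      there must be 0.\<close>
    have "(1 :: real) / a = 0"
    proof (cases "\<delta> dvd d\<^sub>1")
      case True
      have "\<not> int \<delta> dvd 1" using \<open>\<delta> \<noteq> 1\<close> by simp
      then have "{n \<in> digit_set g D. [int n = 1] (mod int a)} = {}"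
        using unif_distributed_in_subgroup_delta[OF True] one
        unfolding unif_distributed_in_subgroup_def residue_subgroup_eq[OF modulus delta_dvd] by blast
      then have "residue_ratio (digit_set g D) a 1 = (\<lambda>_. 0)"
        unfolding residue_ratio_def by (simp only: Int_empty_left) simp
      then show ?thesis using lim LIMSEQ_unique tendsto_const by metis
    next
      case False
      then show ?thesis using residue_ratio_limit_0 lim by blast
    qed
    then show False using modulus by simp
  qed
qed

end

theorem corollary5p5:
  fixes g t a \<delta> :: nat and d :: "nat \<Rightarrow> nat" and D :: "nat set"
  assumes "g \<ge> 2"
    and "t \<ge> 2"
    and "inj_on d {1..t}"
    and "D = d ` {1..t}"
    and "D \<subseteq> {0..g - 1}"
    and "\<forall>j\<in>{1..t}. d 1 \<le> d j"
    and "a \<ge> 1"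
    and "gcd g a = 1"
    and "\<delta> = Gcd (insert a ((\<lambda>j. d j - d 1) ` {2..t}))"
  shows "(unif_distributed_mod (digit_set g D) a \<longleftrightarrow> \<delta> = 1) \<and>
    (\<delta> \<noteq> 1 \<and> [d 1 = 0] (mod \<delta>) \<longrightarrow> unif_distributed_in_subgroup (digit_set g D) a \<delta>) \<and>
    (\<delta> \<noteq> 1 \<and> \<not> [d 1 = 0] (mod \<delta>) \<longrightarrow>
      (\<forall>b \<in> carrier (integer_mod_group a).
        residue_ratio (digit_set g D) a b \<longlonglongrightarrow> 0 \<or> \<not> convergent (residue_ratio (digit_set g D) a b)))"
proof -
  \<comment> \<open>Index 1 only adds the difference 0, which leaves the \<open>Gcd\<close>
    unchanged.\<close>
  have "{1..t} = insert 1 {2..t}" using assms(2) by auto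
  then have "(\<lambda>x. x - d 1) ` D = insert 0 ((\<lambda>j. d j - d 1) ` {2..t})"
    by (simp add: assms(4) image_image)
  then have delta_eq: "\<delta> = Gcd (insert a ((\<lambda>x. x - d 1) ` D))"
    by (simp add: assms(9))
  interpret restricted_digits_mod g D a \<delta> "d 1"
  proof
    show "D \<subseteq> {..<g}" using assms(1,5) by auto
    show "2 \<le> card D" using assms(2-4) by (simp add: card_image)
    show "d 1 \<in> D" using assms(2,4) by simp
    show "d 1 \<le> x" if "x \<in> D" for x using that assms(4,6) by auto
    show "coprime g a" using assms(8) by (simp only: coprime_iff_gcd_eq_1)
    show "\<delta> = Gcd (insert a ((\<lambda>x. x - d 1) ` D))" by (rule delta_eq)
  qed (use assms(1,7) in simp_all)
  show ?thesis
    using unif_distributed_mod_iff unif_distributed_in_subgroup_delta residue_ratio_limit_0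
    unfolding cong_0_iff convergent_def by blast
qed

end
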